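(* Let $n,g,q,r$ be integers with $3\le g\le n-1$, $q\ge 1$, and suppose the unicyclic graph $U_g^{n-g}$ has order $n=q^2+r$ with $1\le r\le 2q+1$. Let $\mathcal A=\{(2q+1,\,q^2-q-2),\ (q^2-2,\,q+1)\}$. If $q\le r\le 2q+1$, or $g\ge q^2+1$, or $g\le 2r$, or $(g,n-g)\in\mathcal A$, then $b(U_g^{n-g})=q+1$.
   Context: All graphs are finite and simple. Burning number: at time $0$ all vertices of $G$ are unburned. In each round $t\ge1$, one new unburned vertex is chosen to burn (if such a vertex exists), and every unburned neighbour of a vertex that was burned by the end of the previous round becomes burned; burned vertices stay burned. The process ends when all vertices are burned. $b(G)$ is the smallest $k$ such that $G$ can be completely burned within $k$ rounds by a suitable choice of vertices. $U_g^{n-g}$ is the unicyclic graph of order $n$ obtained from a cycle $C_g=v_1v_2\cdots v_gv_1$ by attaching at $v_g$ one path contributing $n-g\ge1$ new vertices, one end of which is adjacent to $v_g$. *)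

theory Defs
  imports "Graph_Theory.Pair_Digraph"
begin

text \<open>
  A finite simple graph is a digraph on pairs satisfying the locale \<^locale>\<open>pair_graph\<close>: it is finite,
  loop-free and symmetric, an undirected edge \<open>uv\<close> being the two arcs \<open>(u, v)\<close> and \<open>(v, u)\<close>.
\<close>

inductive burn_round :: "'a pair_pre_digraph \<Rightarrow> 'a set \<Rightarrow> 'a set \<Rightarrow> bool" for G where
  choose: "v \<in> pverts G - B \<Longrightarrow> burn_round G B (insert v (B \<union> {w. \<exists>u\<in>B. (u, w) \<in> parcs G}))"
| finished: "pverts G \<subseteq> B \<Longrightarrow> burn_round G B B"

text \<open>
  \<open>burned_after G k B\<close>: for a suitable choice of vertices, \<open>B\<close> is the set of vertices burned by the
  end of round \<open>k\<close>. The chosen vertex is required to be unburned at the end of the previous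
  round; it may be one that catches fire from a neighbour in the same round.
\<close>

inductive burned_after :: "'a pair_pre_digraph \<Rightarrow> nat \<Rightarrow> 'a set \<Rightarrow> bool" for G where
  start: "burned_after G 0 {}"
| round: "burned_after G k B \<Longrightarrow> burn_round G B B' \<Longrightarrow> burned_after G (Suc k) B'"

definition burning_number :: "'a pair_pre_digraph \<Rightarrow> nat" where
  "burning_number G = (LEAST k. burned_after G k (pverts G))"

text \<open>
  \<open>unicyclic g l\<close> is the graph \<open>U\<^sub>g\<^sup>l\<close>. The vertex \<open>v\<^sub>i\<close> is the number \<open>i\<close>; the cycle is
  \<open>1, \<dots>, g\<close>, and \<open>g + 1, \<dots>, g + l\<close> are the new vertices of the path attached at \<open>g\<close>.
\<close>

definition unicyclic_edges :: "nat \<Rightarrow> nat \<Rightarrow> nat rel" where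
  "unicyclic_edges g l =
     {(i, i + 1) | i. 1 \<le> i \<and> i < g} \<union> {(g, 1)} \<union> {(i, i + 1) | i. g \<le> i \<and> i < g + l}"

definition unicyclic :: "nat \<Rightarrow> nat \<Rightarrow> nat pair_pre_digraph" where
  "unicyclic g l =
     \<lparr>pverts = {1..g + l}, parcs = unicyclic_edges g l \<union> (unicyclic_edges g l)\<inverse>\<rparr>"

lemma pair_graph_unicyclic:
  assumes "3 \<le> g"
  shows "pair_graph (unicyclic g l)"
proof -
  have sub: "parcs (unicyclic g l) \<subseteq> {1..g + l} \<times> {1..g + l}"
    using assms by (auto simp: unicyclic_def unicyclic_edges_def)
  have fin: "finite (parcs (unicyclic g l))"
    by (rule finite_subset[OF sub]) simp
  show ?thesis
  proof
    fix e assume e: "e \<in> parcs (unicyclic g l)"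
    then show "fst e \<in> pverts (unicyclic g l)" "snd e \<in> pverts (unicyclic g l)"
      using sub by (auto simp: unicyclic_def)
    show "fst e \<noteq> snd e"
      using e assms by (auto simp: unicyclic_def unicyclic_edges_def)
  next
    show "finite (pverts (unicyclic g l))" by (simp add: unicyclic_def)
    show "finite (parcs (unicyclic g l))" by (rule fin)
    show "symmetric (with_proj (unicyclic g l))"
      by (auto simp: symmetric_def sym_def unicyclic_def)
  qed
qed

text \<open>The minimum defining \<^const>\<open>burning_number\<close> is taken over a nonempty, upward closed set.\<close>

lemma (in pair_graph) burned_after_subset: "burned_after G k B \<Longrightarrow> B \<subseteq> pverts G"
  by (induction rule: burned_after.induct) (auto elim!: burn_round.cases dest: in_arcsD2)

lemma (in pair_graph) burned_after_card:
  "\<exists>B. burned_after G k B \<and> (B = pverts G \<or> k \<le> card B)"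
proof (induction k)
  case 0
  show ?case using burned_after.start by auto
next
  case (Suc k)
  then obtain B where B: "burned_after G k B" "B = pverts G \<or> k \<le> card B" by blast
  show ?case
  proof (cases "B = pverts G")
    case True
    then show ?thesis
      using B(1) burned_after.round burn_round.finished by (metis order_refl)
  next
    case False
    then obtain v where v: "v \<in> pverts G - B" using burned_after_subset[OF B(1)] by blast
    let ?B' = "insert v (B \<union> {w. \<exists>u\<in>B. (u, w) \<in> parcs G})"
    have b: "burned_after G (Suc k) ?B'"
      by (rule burned_after.round[OF B(1) burn_round.choose[OF v]])
    have "finite ?B'"
      by (rule finite_subset[OF burned_after_subset[OF b] pair_finite_verts])
    then have "card (insert v B) \<le> card ?B'" by (intro card_mono) auto
    moreover have "finite B"
      by (rule finite_subset[OF burned_after_subset[OF B(1)] pair_finite_verts])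
    then have "card (insert v B) = Suc (card B)" using v by simp
    ultimately have "Suc k \<le> card ?B'" using False B(2) by linarith
    with b show ?thesis by blast
  qed
qed

lemma (in pair_graph) burned_after_exists: "\<exists>k. burned_after G k (pverts G)"
proof -
  obtain B where B: "burned_after G (card (pverts G)) B"
    "B = pverts G \<or> card (pverts G) \<le> card B"
    using burned_after_card by blast
  then have "B = pverts G"
    using burned_after_subset[OF B(1)] pair_finite_verts card_seteq by blast
  with B(1) show ?thesis by blast
qed

lemma burned_after_mono:
  "k \<le> k' \<Longrightarrow> burned_after G k (pverts G) \<Longrightarrow> burned_after G k' (pverts G)"
  by (induction k' rule: dec_induct) (auto intro: burned_after.round burn_round.finished)

end

theory Submission
  imports Defs
begin

text \<open>
  A graph can be burned in \<open>k\<close> rounds iff its vertices are covered by \<open>k\<close> balls of radii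
  \<open>0, \<dots>, k - 1\<close>: a vertex chosen \<open>i\<close> rounds before the end burns the ball of radius \<open>i\<close> around it
  (\<open>burned_after_imp_cover\<close>, \<open>cover_imp_burned_after\<close>). On a path such a ball has at most
  \<open>2 * i + 1\<close> vertices, and these bounds add up to \<open>k\<^sup>2\<close>.

  Upper bound. The path \<open>1, 2, \<dots>, n\<close> is a spanning subgraph, and \<open>n \<le> (q + 1)\<^sup>2\<close>, so it is cut into
  intervals of lengths at most \<open>1, 3, \<dots>, 2 * q + 1\<close>.

  Lower bound. Suppose that balls of radii \<open>0, \<dots>, q - 1\<close> cover the graph. Retracting the path onto
  its end on the cycle, or folding the cycle onto half of itself, does not increase distances, so
  it turns the cover into one of a cycle of length \<open>g\<close>, or of a path with \<open>n - g + g div 2 + 1\<close>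
  vertices. Both have at most \<open>q\<^sup>2\<close> vertices then, which excludes \<open>g \<ge> q\<^sup>2 + 1\<close> and \<open>g \<le> 2 * r\<close>.

  For the two other conditions, call \<open>v\<^sub>g\<close> the hub. Three legs leave it: the path and the two
  directions around the cycle. A ball of radius \<open>i\<close> with centre at distance \<open>d \<le> i\<close> from the hub
  reaches depth \<open>i - d\<close> into all legs; let \<open>e\<close> be the largest of these depths, attained by the ball
  of radius \<open>j\<close>. The ball of radius \<open>e\<close> around the hub has at most \<open>3 * e + 1\<close> vertices, and what a
  ball covers outside of it lies on a single leg. That is at most \<open>2 * i + 1\<close> vertices for
  every ball and \<open>2 * (j - e)\<close> for the \<open>j\<close>-th one, which makes at most \<open>q\<^sup>2 + e \<le> q\<^sup>2 + q - 1\<close> in total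
  (\<open>burned_after_hub_decomposition\<close>, \<open>order_less_of_burned_after\<close>). This excludes \<open>r \<ge> q\<close>.

  In the two sporadic cases \<open>n = q\<^sup>2 + q - 1\<close>, so every estimate is an equality: the largest ball is
  centred at the hub, and the others cover odd numbers \<open>1, 3, \<dots>, 2 * q - 3\<close> of the remaining vertices
  without overlap, each of them on the cycle only or on the path only. But just two vertices
  remain on the cycle in the first case and on the path in the second, and \<open>2\<close> is not a sum of
  distinct odd numbers (\<open>not_two_left_of_burned_after\<close>).
\<close>

section \<open>Burning as covering by balls\<close>

definition spread :: "'a pair_pre_digraph \<Rightarrow> 'a set \<Rightarrow> 'a set" where
  "spread G A = A \<union> {w. \<exists>u\<in>A. (u, w) \<in> parcs G}"

abbreviation gball :: "'a pair_pre_digraph \<Rightarrow> 'a \<Rightarrow> nat \<Rightarrow> 'a set" where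
  "gball G c k \<equiv> (spread G ^^ k) {c}"

lemma spread_mono: "A \<subseteq> B \<Longrightarrow> spread G A \<subseteq> spread G B"
  by (auto simp: spread_def)

lemma subset_spread: "A \<subseteq> spread G A"
  by (auto simp: spread_def)

lemma spreadI: "u \<in> A \<Longrightarrow> (u, w) \<in> parcs G \<Longrightarrow> w \<in> spread G A"
  by (auto simp: spread_def)

lemma spreadE:
  assumes "w \<in> spread G A"
  obtains "w \<in> A" | u where "u \<in> A" "(u, w) \<in> parcs G"
  using assms by (auto simp: spread_def)

lemma spread_Union: "spread G (\<Union>i\<in>I. A i) = (\<Union>i\<in>I. spread G (A i))"
  by (auto simp: spread_def)

text \<open>Balls are bounded by exhibiting a family of sets that absorbs one step of the fire per index.\<close>

lemma gball_subset_invariant: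
  assumes "c \<in> S 0" and "\<And>k. spread G (S k) \<subseteq> S (Suc k)"
  shows "gball G c k \<subseteq> S k"
proof (induction k)
  case (Suc k)
  then show ?case using spread_mono[OF Suc] assms(2)[of k] by auto
qed (use assms in auto)

text \<open>
  One more round lets every ball grow by one and adds the last chosen vertex as the ball of radius
  \<open>0\<close>; the centres are therefore numbered from the end of the process.
\<close>

lemma Union_gball_Suc:
  "(\<Union>i<Suc k. gball G (c i) i) = insert (c 0) (spread G (\<Union>i<k. gball G (c (Suc i)) i))"
  unfolding spread_Union lessThan_Suc_eq_insert_0 by auto

lemma burned_after_imp_cover:
  assumes "burned_after G k B" "pverts G \<noteq> {}"
  shows "\<exists>c. (\<forall>i. c i \<in> pverts G) \<and> B \<subseteq> (\<Union>i<k. gball G (c i) i)"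
  using assms(1)
proof (induction rule: burned_after.induct)
  case start
  then show ?case using assms(2) by auto
next
  case (round k B B')
  from round.IH obtain c
    where c: "\<forall>i. c i \<in> pverts G" "B \<subseteq> (\<Union>i<k. gball G (c i) i)" by blast
  obtain v where v: "v \<in> pverts G" "B' \<subseteq> insert v (spread G B)"
    using round.hyps(2) assms(2)
    by (cases rule: burn_round.cases) (auto simp: spread_def)
  let ?c = "case_nat v c"
  have "B' \<subseteq> (\<Union>i<Suc k. gball G (?c i) i)"
    unfolding Union_gball_Suc using v(2) spread_mono[OF c(2)] by auto
  moreover have "\<forall>i. ?c i \<in> pverts G" using c v by (auto split: nat.split)
  ultimately show ?case by blast
qed

text \<open>
  A prescribed centre may already be burned when its turn comes. Then any unburned vertex is
  chosen instead, which only enlarges the burned set.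
\<close>

lemma (in pair_graph) cover_imp_burned_after:
  assumes "\<And>i. i < k \<Longrightarrow> c i \<in> pverts G"
  shows "\<exists>B. burned_after G k B \<and> pverts G \<inter> (\<Union>i<k. gball G (c i) i) \<subseteq> B"
  using assms
proof (induction k arbitrary: c)
  case 0
  then show ?case using burned_after.start by auto
next
  case (Suc k)
  obtain B where B: "burned_after G k B"
    "pverts G \<inter> (\<Union>i<k. gball G (c (Suc i)) i) \<subseteq> B"
    using Suc.IH[of "c \<circ> Suc"] Suc.prems by auto
  show ?case
  proof (cases "pverts G \<subseteq> B")
    case True
    then show ?thesis using burned_after.round[OF B(1) burn_round.finished] by blast
  next
    case False
    \<comment> \<open>A burned \<open>c 0\<close> stays burned, so the choice is free in that case.\<close>
    define v where "v = (if c 0 \<in> B then SOME v. v \<in> pverts G - B else c 0)"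
    have v: "v \<in> pverts G - B" using False Suc.prems[of 0] some_in_eq[of "pverts G - B"]
      by (auto simp: v_def)
    let ?B = "insert v (spread G B)"
    have "burned_after G (Suc k) ?B"
      using burned_after.round[OF B(1) burn_round.choose[OF v]] by (simp add: spread_def)
    moreover have "pverts G \<inter> (\<Union>i<Suc k. gball G (c i) i) \<subseteq> ?B"
    proof -
      have "pverts G \<inter> spread G (\<Union>i<k. gball G (c (Suc i)) i) \<subseteq> spread G B"
        using B(2) by (auto simp: spread_def dest: in_arcsD1)
      moreover have "c 0 \<in> ?B" by (auto simp: v_def spread_def)
      ultimately show ?thesis unfolding Union_gball_Suc by blast
    qed
    ultimately show ?thesis by blast
  qed
qed

lemma sum_odd_squares: "(\<Sum>i<k. 2 * i + 1) = (k::nat)\<^sup>2"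
  by (induction k) (auto simp: power2_eq_square)

section \<open>Burning along the Hamiltonian path\<close>

lemma pverts_unicyclic [simp]: "pverts (unicyclic g l) = {1..g + l}"
  by (simp add: unicyclic_def)

lemma unicyclic_arc_iff:
  assumes "3 \<le> g"
  shows "(u, w) \<in> parcs (unicyclic g l) \<longleftrightarrow>
    1 \<le> u \<and> 1 \<le> w \<and> u \<le> g + l \<and> w \<le> g + l \<and>
    (w = u + 1 \<or> u = w + 1 \<or> (u = g \<and> w = 1) \<or> (u = 1 \<and> w = g))"
proof -
  have "(a, b) \<in> unicyclic_edges g l \<longleftrightarrow>
      (1 \<le> a \<and> a < g + l \<and> b = a + 1) \<or> (a = g \<and> b = 1)" for a b
    using assms unfolding unicyclic_edges_def by auto
  then show ?thesis using assms unfolding unicyclic_def by auto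
qed

text \<open>
  The numbering of the vertices follows a Hamiltonian path, so differences of numbers bound
  distances from above.
\<close>

lemma interval_subset_gball:
  assumes "3 \<le> g" "x \<in> {1..g + l}" "c \<in> {1..g + l}" "x \<le> c + k" "c \<le> x + k"
  shows "x \<in> gball (unicyclic g l) c k"
  using assms(2,4,5)
proof (induction k arbitrary: x)
  case (Suc k)
  consider "x \<le> c + k" "c \<le> x + k" | "x = c + Suc k" | "c = x + Suc k"
    using Suc.prems by linarith
  then show ?case
  proof cases
    case 1
    then show ?thesis using Suc subset_spread by fastforce
  next
    case 2
    then have "x - 1 \<in> gball (unicyclic g l) c k" using Suc assms(3) by auto
    moreover have "(x - 1, x) \<in> parcs (unicyclic g l)"
      using 2 Suc.prems assms(1,3) by (auto simp: unicyclic_arc_iff)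
    ultimately show ?thesis by (simp add: spreadI)
  next
    case 3
    then have "x + 1 \<in> gball (unicyclic g l) c k" using Suc assms(3) by auto
    moreover have "(x + 1, x) \<in> parcs (unicyclic g l)"
      using 3 Suc.prems assms(1,3) by (auto simp: unicyclic_arc_iff)
    ultimately show ?thesis by (simp add: spreadI)
  qed
qed (use assms in auto)

lemma ex_square_bracket: "\<exists>i. i\<^sup>2 < x \<and> x \<le> (i + 1)\<^sup>2" if "1 \<le> x" for x :: nat
  using that
proof (induction x rule: dec_induct)
  case base
  show ?case by (intro exI[of _ 0]) simp
next
  case (step x)
  then obtain i where i: "i\<^sup>2 < x" "x \<le> (i + 1)\<^sup>2" by blast
  show ?case
  proof (cases "x = (i + 1)\<^sup>2")
    case True
    then show ?thesis by (intro exI[of _ "i + 1"]) (auto simp: power2_eq_square)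
  next
    case False
    then show ?thesis using i by (intro exI[of _ i]) auto
  qed
qed

text \<open>
  The ball of radius \<open>i\<close> is in charge of the vertices in \<open>{i\<^sup>2<..(i + 1)\<^sup>2}\<close>, whose midpoint is
  \<open>i\<^sup>2 + i + 1\<close>. If that is not a vertex, the last vertex serves as well, because at most
  \<open>i\<close> vertices of this interval exist.
\<close>

lemma unicyclic_burned_after_root:
  assumes "3 \<le> g" "g + l \<le> k\<^sup>2"
  shows "burned_after (unicyclic g l) k {1..g + l}"
proof -
  interpret pair_graph "unicyclic g l" using assms(1) by (rule pair_graph_unicyclic)
  define c where "c i = min (g + l) (i\<^sup>2 + i + 1)" for i
  have c: "c i \<in> {1..g + l}" for i using assms(1) by (auto simp: c_def)
  have "x \<in> (\<Union>i<k. gball (unicyclic g l) (c i) i)" if x: "x \<in> {1..g + l}" for x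
  proof -
    obtain i where i: "i\<^sup>2 < x" "x \<le> (i + 1)\<^sup>2" using ex_square_bracket[of x] x by auto
    have "i\<^sup>2 < k\<^sup>2" using i(1) x assms(2) by auto
    then have "i < k" by (rule power_less_imp_less_base) simp
    moreover have "x \<in> gball (unicyclic g l) (c i) i"
      using i x by (intro interval_subset_gball[OF assms(1) x c])
        (auto simp: c_def power2_eq_square)
    ultimately show ?thesis by blast
  qed
  then have cover: "{1..g + l} \<subseteq> (\<Union>i<k. gball (unicyclic g l) (c i) i)" by blast
  obtain B where B: "burned_after (unicyclic g l) k B"
    "pverts (unicyclic g l) \<inter> (\<Union>i<k. gball (unicyclic g l) (c i) i) \<subseteq> B"
    using cover_imp_burned_after[of k c] c by auto
  have "B = {1..g + l}" using B(2) cover burned_after_subset[OF B(1)] by auto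
  with B(1) show ?thesis by simp
qed

section \<open>Images in paths and cycles\<close>

text \<open>
  A map that moves by at most one along arcs does not increase distances, so each ball has an image
  in an arc of \<open>2 * i + 1\<close> residues. With \<open>m = 0\<close> the target is the integer line, since \<open>x mod 0 = x\<close>.
\<close>

lemma card_image_burned_after_le:
  fixes f :: "'a \<Rightarrow> int" and m :: int
  assumes burned: "burned_after G k (pverts G)"
    and arc: "\<And>u w. (u, w) \<in> parcs G \<Longrightarrow> \<exists>j\<in>{-1..1}. f w mod m = (f u + j) mod m"
  shows "card ((\<lambda>x. f x mod m) ` pverts G) \<le> k\<^sup>2"
proof (cases "pverts G = {}")
  case False
  then obtain c where c: "pverts G \<subseteq> (\<Union>i<k. gball G (c i) i)"
    using burned_after_imp_cover[OF burned] by blast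
  define S where "S c i = {x. \<exists>j\<in>{- int i..int i}. f x mod m = (f c + j) mod m}" for c i
  have S: "gball G c i \<subseteq> S c i" for c i
  proof (rule gball_subset_invariant)
    show "spread G (S c i) \<subseteq> S c (Suc i)" for i
    proof
      fix w assume "w \<in> spread G (S c i)"
      then obtain u where u: "u \<in> S c i" "w = u \<or> (u, w) \<in> parcs G"
        unfolding spread_def by blast
      obtain j where j: "j \<in> {-1..1}" "f w mod m = (f u + j) mod m"
      proof (cases "w = u")
        case True
        then show ?thesis using that[of 0] by simp
      qed (use u(2) arc[of u w] that in blast)
      from u(1) obtain j' where j': "j' \<in> {- int i..int i}" "f u mod m = (f c + j') mod m"
        unfolding S_def by blast
      have "(f u + j) mod m = (f c + j' + j) mod m" by (rule mod_add_cong[OF j'(2) refl])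
      with j(2) have "f w mod m = (f c + (j' + j)) mod m" by (simp only: add.assoc)
      then show "w \<in> S c (Suc i)" using j(1) j'(1) unfolding S_def
        by (intro CollectI bexI[of _ "j' + j"]) simp_all
    qed
  qed (auto simp: S_def)
  let ?I = "\<lambda>i. (\<lambda>j. (f (c i) + j) mod m) ` {- int i..int i}"
  have "(\<lambda>x. f x mod m) ` pverts G \<subseteq> (\<Union>i<k. ?I i)"
  proof (rule image_subsetI)
    fix x assume "x \<in> pverts G"
    then obtain i where "i < k" "x \<in> S (c i) i" using c S by blast
    then show "f x mod m \<in> (\<Union>i<k. ?I i)" by (auto simp: S_def)
  qed
  then have "card ((\<lambda>x. f x mod m) ` pverts G) \<le> card (\<Union>i<k. ?I i)"
    by (intro card_mono) auto
  also have "\<dots> \<le> (\<Sum>i<k. card (?I i))" by (rule card_UN_le) simp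
  also have "\<dots> \<le> (\<Sum>i<k. 2 * i + 1)"
    by (intro sum_mono order_trans[OF card_image_le]) auto
  finally show ?thesis by (simp only: sum_odd_squares)
qed auto

text \<open>The path is retracted onto its attaching vertex \<open>g\<close>, which leaves the cycle modulo \<open>g\<close>.\<close>

lemma girth_le_square_of_burned_after:
  assumes "3 \<le> g" "burned_after (unicyclic g l) k {1..g + l}"
  shows "g \<le> k\<^sup>2"
proof -
  let ?f = "\<lambda>x. int (min x g)"
  have "card ((\<lambda>x. ?f x mod int g) ` pverts (unicyclic g l)) \<le> k\<^sup>2"
  proof (rule card_image_burned_after_le)
    fix u w assume "(u, w) \<in> parcs (unicyclic g l)"
    then consider "u < g" "w = u + 1" | "w < g" "u = w + 1" | "u \<ge> g" "w \<ge> g"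
      | "u = g" "w = 1" | "u = 1" "w = g"
      unfolding unicyclic_arc_iff[OF assms(1)] by linarith
    then show "\<exists>j\<in>{-1..1}. ?f w mod int g = (?f u + j) mod int g"
    proof cases
      case 1
      then show ?thesis by (intro bexI[of _ 1]) (auto simp: add.commute)
    next
      case 2
      then show ?thesis by (intro bexI[of _ "-1"]) auto
    next
      case 3
      then show ?thesis by (intro bexI[of _ 0]) auto
    next
      case 4
      then show ?thesis using assms(1) by (intro bexI[of _ 1]) auto
    next
      case 5
      then show ?thesis using assms(1) by (intro bexI[of _ "-1"]) auto
    qed
  qed (use assms in auto)
  moreover have "int ` {0..<g} \<subseteq> (\<lambda>x. ?f x mod int g) ` pverts (unicyclic g l)"
  proof (rule image_subsetI)
    fix x assume "x \<in> {0..<g}"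
    then show "int x \<in> (\<lambda>x. ?f x mod int g) ` pverts (unicyclic g l)"
      using assms(1) by (intro image_eqI[of _ _ "if x = 0 then g else x"]) auto
  qed
  then have "card (int ` {0..<g}) \<le> card ((\<lambda>x. ?f x mod int g) ` pverts (unicyclic g l))"
    by (intro card_mono) auto
  ultimately show ?thesis by (simp add: card_image)
qed

text \<open>
  The cycle is folded onto half of itself, with \<open>g\<close> at \<open>0\<close>, the path on the positive side
  and the two halves of the cycle laid over each other on the negative side.
\<close>

lemma geodesic_le_square_of_burned_after:
  assumes "3 \<le> g" "burned_after (unicyclic g l) k {1..g + l}"
  shows "g div 2 + l + 1 \<le> k\<^sup>2"
proof -
  let ?f = "\<lambda>x. if x \<ge> g then int x - int g else - int (min x (g - x))"
  have "card ((\<lambda>x. ?f x mod 0) ` pverts (unicyclic g l)) \<le> k\<^sup>2"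
  proof (rule card_image_burned_after_le)
    fix u w assume "(u, w) \<in> parcs (unicyclic g l)"
    then show "\<exists>j\<in>{-1..1}. ?f w mod 0 = (?f u + j) mod 0"
      using assms(1) unfolding unicyclic_arc_iff[OF assms(1)]
      by (intro bexI[of _ "?f w - ?f u"]) (auto simp: min_def)
  qed (use assms in auto)
  moreover have "{- int (g div 2)..int l} \<subseteq> (\<lambda>x. ?f x mod 0) ` pverts (unicyclic g l)"
  proof
    fix t assume t: "t \<in> {- int (g div 2)..int l}"
    show "t \<in> (\<lambda>x. ?f x mod 0) ` pverts (unicyclic g l)"
      using t assms(1)
      by (intro image_eqI[of _ _ "if 0 \<le> t then g + nat t else nat (- t)"])
        (auto simp: min_def nat_less_iff)
  qed
  then have "card {- int (g div 2)..int l}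
      \<le> card ((\<lambda>x. ?f x mod 0) ` pverts (unicyclic g l))"
    by (intro card_mono) auto
  ultimately show ?thesis by (auto simp: nat_add_distrib)
qed

section \<open>The three legs at the hub\<close>

text \<open>
  A leg walks away from the hub \<open>g\<close>, starting there at time \<open>0\<close>. Legs are total functions: on the cycle they
  wind around for ever, and on the path they run past its end. Covering more than
  the graph is harmless for upper bounds, and it avoids all case distinctions on short cycles.
\<close>

definition up_leg :: "nat \<Rightarrow> nat \<Rightarrow> nat" where
  "up_leg g x = (if x mod g = 0 then g else x mod g)"

definition down_leg :: "nat \<Rightarrow> nat \<Rightarrow> nat" where
  "down_leg g x = g - x mod g"

definition legs :: "nat \<Rightarrow> (nat \<Rightarrow> nat) set" where
  "legs g = {up_leg g, down_leg g, \<lambda>x. g + x}"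

definition hub_ball :: "nat \<Rightarrow> nat \<Rightarrow> nat set" where
  "hub_ball g e = (\<Union>\<phi>\<in>legs g. \<phi> ` {..e})"

lemma leg_0: "\<phi> \<in> legs g \<Longrightarrow> \<phi> 0 = g"
  by (auto simp: legs_def up_leg_def down_leg_def)

lemma leg_side:
  assumes "3 \<le> g" "\<phi> \<in> legs g"
  shows "\<phi> ` {1..} \<subseteq> {..g} \<or> \<phi> ` {1..} \<subseteq> {g<..}"
proof -
  have "x mod g \<le> g" for x using assms(1) mod_less_divisor[of g x] by linarith
  then show ?thesis using assms(2) by (auto simp: legs_def up_leg_def down_leg_def)
qed

text \<open>
  Fire moves along a leg, or passes from the hub to the first vertex of another leg. A winding leg
  meets the hub again only at times \<open>x \<ge> g\<close>.
\<close>

lemma leg_neighbour: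
  assumes g: "3 \<le> g" and \<phi>: "\<phi> \<in> legs g" and arc: "(\<phi> x, w) \<in> parcs (unicyclic g l)"
  shows "w = \<phi> (x + 1) \<or> (1 \<le> x \<and> w = \<phi> (x - 1)) \<or>
    ((x = 0 \<or> g \<le> x) \<and> (\<exists>\<psi>\<in>legs g. w = \<psi> 1))"
proof -
  have hub: "\<exists>\<psi>\<in>legs g. w = \<psi> 1" if "w = 1 \<or> w + 1 = g \<or> w = g + 1"
    using that g by (auto simp: legs_def up_leg_def down_leg_def)
  have nb: "w = \<phi> x + 1 \<or> \<phi> x = w + 1 \<or> (\<phi> x = g \<and> w = 1) \<or> (\<phi> x = 1 \<and> w = g)"
    "1 \<le> w" using arc unicyclic_arc_iff[OF g] by auto
  have lt: "y mod g < g" for y using g by simp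
  show ?thesis
  proof (cases x)
    case 0
    then show ?thesis using hub nb g leg_0[OF \<phi>] by auto
  next
    case (Suc y)
    have m: "x mod g = (if Suc (y mod g) = g then 0 else Suc (y mod g))"
      "Suc x mod g = (if Suc (x mod g) = g then 0 else Suc (x mod g))"
      unfolding Suc by (rule mod_Suc)+
    have hub': ?thesis if "x mod g = 0" "\<phi> x = g"
    proof -
      have "g \<le> x" using that(1) Suc by (simp add: mod_eq_0_iff_dvd dvd_imp_le)
      moreover have "w = 1 \<or> w + 1 = g \<or> w = g + 1" using nb(1) that(2) g by auto
      ultimately show ?thesis using hub by blast
    qed
    have y: "x - Suc 0 = y" using Suc by simp
    consider "\<phi> = up_leg g" | "\<phi> = down_leg g" | "\<phi> = (\<lambda>x. g + x)"
      using \<phi> by (auto simp: legs_def)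
    then show ?thesis
    proof cases
      case 1
      show ?thesis
      proof (cases "x mod g = 0")
        case True
        then show ?thesis using hub' by (simp add: 1 up_leg_def)
      next
        case False
        then have b: "x mod g = Suc (y mod g)" using m(1) by (auto split: if_splits)
        then have "\<phi> x = x mod g" "\<phi> (x + 1) = x mod g + 1"
          "\<phi> (x - 1) = (if x mod g = 1 then g else x mod g - 1)"
          using m(2) by (simp_all add: 1 up_leg_def y)
        then show ?thesis using nb lt[of x] b Suc by (auto split: if_splits)
      qed
    next
      case 2
      show ?thesis
      proof (cases "x mod g = 0")
        case True
        then show ?thesis using hub' by (simp add: 2 down_leg_def)
      next
        case False
        then have b: "x mod g = Suc (y mod g)" using m(1) by (auto split: if_splits)
        then have "\<phi> x = g - x mod g" "\<phi> (x - 1) = g - x mod g + 1"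
          "\<phi> (x + 1) = (if g = x mod g + 1 then g else g - x mod g - 1)"
          using m(2) lt[of x] by (simp_all add: 2 down_leg_def y)
        then show ?thesis using nb lt[of x] b Suc by (auto split: if_splits)
      qed
    next
      case 3
      show ?thesis using nb g Suc unfolding 3 by auto
    qed
  qed
qed

text \<open>On the cycle the shorter way to the hub is taken, so that \<open>d\<close> is the distance to the hub.\<close>

lemma ex_leg_through:
  assumes "3 \<le> g" "1 \<le> c"
  shows "\<exists>\<phi>\<in>legs g. \<exists>d. c = \<phi> d \<and> (2 * d \<le> g \<or> \<phi> = (\<lambda>x. g + x))"
proof -
  consider "2 * c \<le> g" | "g < 2 * c" "c < g" | "g \<le> c" by linarith
  then show ?thesis
  proof cases
    case 1
    then show ?thesis using assms
      by (intro bexI[of _ "up_leg g"] exI[of _ c]) (auto simp: legs_def up_leg_def)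
  next
    case 2
    then show ?thesis using assms
      by (intro bexI[of _ "down_leg g"] exI[of _ "g - c"]) (auto simp: legs_def down_leg_def)
  next
    case 3
    then show ?thesis
      by (intro bexI[of _ "\<lambda>x. g + x"] exI[of _ "c - g"]) (auto simp: legs_def)
  qed
qed

text \<open>
  A bound for the ball of radius \<open>k\<close> around \<open>\<phi> d\<close>: an interval on the leg \<open>\<phi>\<close> itself, and whatever the fire
  reaches through the hub, with \<open>k - d\<close> steps left there. For \<open>k < d\<close> the second part is empty, which the additive
  form of the bounds takes care of.
\<close>

definition leg_ball :: "nat \<Rightarrow> (nat \<Rightarrow> nat) \<Rightarrow> nat \<Rightarrow> nat \<Rightarrow> nat set" where
  "leg_ball g \<phi> d k =
     {\<phi> x | x. d \<le> x + k \<and> x \<le> d + k} \<union> {\<psi> y | \<psi> y. \<psi> \<in> legs g \<and> d + y \<le> k}"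

lemma leg_ballI1: "d \<le> x + k \<Longrightarrow> x \<le> d + k \<Longrightarrow> \<phi> x \<in> leg_ball g \<phi> d k"
  by (auto simp: leg_ball_def)

lemma leg_ballI2: "\<psi> \<in> legs g \<Longrightarrow> d + y \<le> k \<Longrightarrow> \<psi> y \<in> leg_ball g \<phi> d k"
  by (auto simp: leg_ball_def)

lemma leg_ballE:
  assumes "w \<in> leg_ball g \<phi> d k"
  obtains x where "w = \<phi> x" "d \<le> x + k" "x \<le> d + k"
    | \<psi> y where "w = \<psi> y" "\<psi> \<in> legs g" "d + y \<le> k"
  using assms by (auto simp: leg_ball_def)

text \<open>
  The critical point is a winding leg \<open>\<phi>\<close> that comes back to the hub at a time \<open>x \<ge> g\<close>. As the shorter way
  was taken, \<open>x \<ge> 2 * d\<close>, and \<open>x \<le> d + k\<close> gives \<open>d \<le> k\<close>: the hub burned earlier by the direct way.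
\<close>

lemma spread_leg_ball:
  assumes g: "3 \<le> g" and \<phi>: "\<phi> \<in> legs g" "2 * d \<le> g \<or> \<phi> = (\<lambda>x. g + x)"
  shows "spread (unicyclic g l) (leg_ball g \<phi> d k) \<subseteq> leg_ball g \<phi> d (Suc k)"
proof
  fix w
  have hub: "w \<in> leg_ball g \<phi> d (Suc k)" if "d \<le> k" "\<exists>\<psi>\<in>legs g. w = \<psi> 1"
    using that leg_ballI2[of _ g d 1 "Suc k" \<phi>] by auto
  assume "w \<in> spread (unicyclic g l) (leg_ball g \<phi> d k)"
  then show "w \<in> leg_ball g \<phi> d (Suc k)"
  proof (cases rule: spreadE)
    case 1
    then show ?thesis by (cases rule: leg_ballE) (simp_all add: leg_ballI1 leg_ballI2)
  next
    case (2 u)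
    from 2(1) show ?thesis
    proof (cases rule: leg_ballE)
      case (1 x)
      consider "w = \<phi> (x + 1)" | "1 \<le> x" "w = \<phi> (x - 1)"
        | "x = 0 \<or> g \<le> x" "\<exists>\<psi>\<in>legs g. w = \<psi> 1"
        using leg_neighbour[OF g \<phi>(1) 2(2)[unfolded 1(1)]] by blast
      then show ?thesis
      proof cases
        case 3
        show ?thesis
        proof (cases "d \<le> k")
          \<comment> \<open>Only the straight leg remains; it never returns to the hub.\<close>
          case False
          then have x: "1 \<le> x" and path: "\<phi> = (\<lambda>x. g + x)" using 1 3(1) \<phi>(2) by auto
          have "w = u + 1 \<or> u = w + 1"
            using 2(2) x g unfolding unicyclic_arc_iff[OF g] 1(1) path by auto
          then have "w = \<phi> (x + 1) \<or> w = \<phi> (x - 1)" using x unfolding 1(1) path by auto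
          then show ?thesis using 1 x by (elim disjE) (simp_all only:, auto intro!: leg_ballI1)
        qed (use hub 3(2) in blast)
      qed (use 1 in \<open>auto intro!: leg_ballI1\<close>)
    next
      case b: (2 \<psi> y)
      from leg_neighbour[OF g b(2) 2(2)[unfolded b(1)]]
      consider "w = \<psi> (y + 1)" | "w = \<psi> (y - 1)" | "\<exists>\<psi>\<in>legs g. w = \<psi> 1" by blast
      then show ?thesis
      proof cases
        case 3
        then show ?thesis using hub b(3) by simp
      qed (use b in \<open>simp_all add: leg_ballI2\<close>)
    qed
  qed
qed

lemma gball_subset_leg_ball:
  assumes g: "3 \<le> g" and "1 \<le> c"
  shows "\<exists>\<phi>\<in>legs g. \<exists>d. \<forall>k. gball (unicyclic g l) c k \<subseteq> leg_ball g \<phi> d k"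
proof -
  obtain \<phi> d where \<phi>: "\<phi> \<in> legs g" "c = \<phi> d" "2 * d \<le> g \<or> \<phi> = (\<lambda>x. g + x)"
    using ex_leg_through[OF assms] by blast
  have "gball (unicyclic g l) c k \<subseteq> leg_ball g \<phi> d k" for k
    by (rule gball_subset_invariant) (simp_all add: spread_leg_ball[OF g \<phi>(1,3)] \<phi>(2) leg_ballI1)
  then show ?thesis using \<phi>(1) by blast
qed

lemma finite_hub_ball: "finite (hub_ball g e)"
  by (simp add: hub_ball_def legs_def)

lemma card_hub_ball_le: "card (hub_ball g e) \<le> 3 * e + 1"
proof -
  have "hub_ball g e \<subseteq> insert g
    (up_leg g ` {1..e} \<union> down_leg g ` {1..e} \<union> (\<lambda>x. g + x) ` {1..e})" (is "_ \<subseteq> ?R")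
  proof
    fix v assume "v \<in> hub_ball g e"
    then obtain \<phi> x where "\<phi> \<in> legs g" "v = \<phi> x" "x \<le> e" by (auto simp: hub_ball_def)
    then show "v \<in> ?R"
      by (cases "x = 0") (auto simp: leg_0 legs_def)
  qed
  then have "card (hub_ball g e) \<le> card ?R" by (intro card_mono) auto
  also have "\<dots> \<le> Suc (card (up_leg g ` {1..e}) + card (down_leg g ` {1..e})
      + card ((\<lambda>x. g + x) ` {1..e}))"
    using card_Un_le[of "up_leg g ` {1..e}" "down_leg g ` {1..e}"]
      card_Un_le[of "up_leg g ` {1..e} \<union> down_leg g ` {1..e}" "(\<lambda>x. g + x) ` {1..e}"]
    by (simp add: card_insert_if)
  also have "\<dots> \<le> 3 * e + 1"
    using card_image_le[of "{1..e}" "up_leg g"] card_image_le[of "{1..e}" "down_leg g"]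
      card_image_le[of "{1..e}" "\<lambda>x. g + x"] by simp
  finally show ?thesis .
qed

section \<open>Counting around the hub\<close>

text \<open>
  The set \<open>Y i\<close> is what the ball of radius \<open>i\<close> covers outside the largest hub ball contained in one of
  the balls. A ball that reaches depth \<open>i - d\<close> at the hub contributes the times in
  \<open>{e<..d + i}\<close> on its leg; for the ball \<open>j\<close> that attains \<open>e = j - d\<close> these are only
  \<open>2 * d = 2 * (j - e)\<close> many.
\<close>

lemma burned_after_hub_decomposition:
  assumes g: "3 \<le> g" and burned: "burned_after (unicyclic g l) q {1..g + l}"
    and large: "q\<^sup>2 < g + l"
  shows "\<exists>j<q. \<exists>e\<le>j. \<exists>Y. {1..g + l} \<subseteq> hub_ball g e \<union> (\<Union>i<q. Y i) \<and>
    (\<forall>i. finite (Y i) \<and> card (Y i) \<le> 2 * i + 1 \<and> (Y i \<subseteq> {..g} \<or> Y i \<subseteq> {g<..})) \<and>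
    card (Y j) \<le> 2 * (j - e)"
proof -
  obtain c where c: "\<And>i. c i \<in> {1..g + l}"
    "{1..g + l} \<subseteq> (\<Union>i<q. gball (unicyclic g l) (c i) i)"
    using burned_after_imp_cover[of "unicyclic g l" q, OF burned] g by fastforce
  have "\<exists>\<phi> d. \<phi> \<in> legs g \<and> gball (unicyclic g l) (c i) i \<subseteq> leg_ball g \<phi> d i" for i
    using gball_subset_leg_ball[OF g, of "c i" l] c(1)[of i] by auto
  then obtain \<phi> d where \<phi>: "\<And>i. \<phi> i \<in> legs g"
    and ball: "\<And>i. gball (unicyclic g l) (c i) i \<subseteq> leg_ball g (\<phi> i) (d i) i"
    by metis
  have X: "finite {x. d \<le> x + i \<and> x \<le> d + i}" "card {x. d \<le> x + i \<and> x \<le> d + i} \<le> 2 * i + 1"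
    for d i :: nat
  proof -
    have "{x. d \<le> x + i \<and> x \<le> d + i} = {d - i..d + i}" by auto
    then show "finite {x. d \<le> x + i \<and> x \<le> d + i}"
      "card {x. d \<le> x + i \<and> x \<le> d + i} \<le> 2 * i + 1" by auto
  qed
  define J where "J = {i. i < q \<and> d i \<le> i}"
  \<comment> \<open>Without a ball that contains the hub, all balls are intervals on legs and cover too little.\<close>
  have "J \<noteq> {}"
  proof
    assume "J = {}"
    then have "gball (unicyclic g l) (c i) i \<subseteq> \<phi> i ` {x. d i \<le> x + i \<and> x \<le> d i + i}"
      if "i < q" for i using ball[of i] that by (fastforce simp: J_def leg_ball_def)
    then have "{1..g + l} \<subseteq> (\<Union>i<q. \<phi> i ` {x. d i \<le> x + i \<and> x \<le> d i + i})"
      by (intro order_trans[OF c(2) UN_mono]) auto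
    then have "card {1..g + l} \<le> card (\<Union>i<q. \<phi> i ` {x. d i \<le> x + i \<and> x \<le> d i + i})"
      by (intro card_mono) (auto simp: X)
    also have "\<dots> \<le> (\<Sum>i<q. card (\<phi> i ` {x. d i \<le> x + i \<and> x \<le> d i + i}))"
      by (rule card_UN_le) simp
    also have "\<dots> \<le> (\<Sum>i<q. 2 * i + 1)"
      by (intro sum_mono order_trans[OF card_image_le] X)
    finally show False using large by (simp only: sum_odd_squares) simp
  qed
  moreover have "finite J" by (simp add: J_def)
  ultimately have "Max ((\<lambda>i. i - d i) ` J) \<in> (\<lambda>i. i - d i) ` J" by (intro Max_in) auto
  then obtain j where "j \<in> J" "Max ((\<lambda>i. i - d i) ` J) = j - d j" by (elim imageE)
  with \<open>finite J\<close> have j: "j \<in> J" "\<And>i. i \<in> J \<Longrightarrow> i - d i \<le> j - d j"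
    using Max_ge[of "(\<lambda>i. i - d i) ` J"] by auto
  define e where "e = j - d j"
  have e: "i \<le> d i + e" if "i < q" for i
    using j(2)[of i] that by (cases "d i \<le> i") (auto simp: J_def e_def)
  define Y where "Y i = \<phi> i ` {x. d i \<le> x + i \<and> x \<le> d i + i \<and> e < x}" for i
  have sub: "{x. d \<le> x + i \<and> x \<le> d + i \<and> e < x} \<subseteq> {x. d \<le> x + i \<and> x \<le> d + i}"
    for d i by auto
  have fin: "finite {x. d \<le> x + i \<and> x \<le> d + i \<and> e < x}" for d i
    by (rule finite_subset[OF sub X(1)])
  have cardY: "card (Y i) \<le> 2 * i + 1" for i
    unfolding Y_def by (intro order_trans[OF card_image_le[OF fin]]
        order_trans[OF card_mono[OF X(1) sub]] X(2))
  have sideY: "Y i \<subseteq> {..g} \<or> Y i \<subseteq> {g<..}" for i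
  proof -
    have "Y i \<subseteq> \<phi> i ` {1..}" by (auto simp: Y_def)
    then show ?thesis using leg_side[OF g \<phi>[of i]] by blast
  qed
  have "gball (unicyclic g l) (c i) i \<subseteq> hub_ball g e \<union> Y i" if i: "i < q" for i
  proof
    fix v assume "v \<in> gball (unicyclic g l) (c i) i"
    then have "v \<in> leg_ball g (\<phi> i) (d i) i" using ball[of i] by blast
    then show "v \<in> hub_ball g e \<union> Y i"
    proof (cases rule: leg_ballE)
      case (1 x)
      then show ?thesis using \<phi>[of i] by (cases "e < x")
        (auto simp: Y_def hub_ball_def not_less intro!: bexI[of _ "\<phi> i"])
    next
      case (2 \<psi> y)
      then have "y \<le> e" using e[OF i] by simp
      then show ?thesis using 2 by (auto simp: hub_ball_def)
    qed
  qed
  then have "{1..g + l} \<subseteq> (\<Union>i<q. hub_ball g e \<union> Y i)"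
    by (intro order_trans[OF c(2) UN_mono]) auto
  then have cover: "{1..g + l} \<subseteq> hub_ball g e \<union> (\<Union>i<q. Y i)"
    by (rule order_trans) (intro UN_least Un_mono order_refl UN_upper)
  have "card (Y j) \<le> card {e<..d j + j}"
    unfolding Y_def by (intro order_trans[OF card_image_le[OF fin]] card_mono) auto
  then have "card (Y j) \<le> 2 * (j - e)" using j(1) by (auto simp: e_def J_def)
  moreover have "j < q" "e \<le> j" using j(1) by (auto simp: J_def e_def)
  moreover have "finite (Y i)" for i unfolding Y_def by (intro finite_imageI fin)
  ultimately show ?thesis using cover cardY sideY
    by (intro exI[of _ j] conjI exI[of _ e] exI[of _ Y] allI) simp_all
qed

text \<open>A deficit \<open>s\<close> of one of the sets is a deficit of the union.\<close>

lemma card_UN_le_odd_sum: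
  assumes "\<And>i. i < q \<Longrightarrow> card (Y i) \<le> 2 * i + 1" "j < q" "card (Y j) + s \<le> 2 * j + 1"
  shows "card (\<Union>i<q. Y i) + s \<le> q\<^sup>2"
proof -
  have "card (\<Union>i<q. Y i) + s \<le> (\<Sum>i<q. card (Y i)) + s"
    using card_UN_le[of "{..<q}" Y] by simp
  also have "\<dots> = card (Y j) + s + (\<Sum>i\<in>{..<q} - {j}. card (Y i))"
    using assms(2) by (subst sum.remove[of _ j]) auto
  also have "\<dots> \<le> 2 * j + 1 + (\<Sum>i\<in>{..<q} - {j}. 2 * i + 1)"
    by (rule add_mono[OF assms(3) sum_mono]) (use assms(1) in auto)
  also have "\<dots> = (\<Sum>i<q. 2 * i + 1)"
    using assms(2) by (subst (2) sum.remove[of _ j]) auto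
  finally show ?thesis by (simp only: sum_odd_squares)
qed

text \<open>
  The hub ball costs \<open>3 * e + 1\<close> vertices, and the ball that contains it has a deficit of \<open>2 * e + 1\<close>
  outside; the balance is \<open>e\<close>.
\<close>

lemma order_le_of_hub_decomposition:
  assumes "{1..g + l} \<subseteq> hub_ball g e \<union> (\<Union>i<q. Y i)" "j < q" "e \<le> j"
    and "\<And>i. finite (Y i)" "\<And>i. card (Y i) \<le> 2 * i + 1" "card (Y j) \<le> 2 * (j - e)"
  shows "g + l \<le> q\<^sup>2 + e"
proof -
  have "card {1..g + l} \<le> card (hub_ball g e \<union> (\<Union>i<q. Y i))"
    using assms(1,4) by (intro card_mono) (auto simp: finite_hub_ball)
  also have "\<dots> \<le> card (hub_ball g e) + card (\<Union>i<q. Y i)" by (rule card_Un_le)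
  also have "\<dots> \<le> 3 * e + 1 + card (\<Union>i<q. Y i)" using card_hub_ball_le[of g e] by simp
  finally have "g + l \<le> 3 * e + 1 + card (\<Union>i<q. Y i)" by simp
  moreover have "card (\<Union>i<q. Y i) + (2 * e + 1) \<le> q\<^sup>2"
    using assms by (intro card_UN_le_odd_sum[where j = j]) auto
  ultimately show ?thesis by simp
qed

lemma order_less_of_burned_after:
  assumes "3 \<le> g" "1 \<le> q" "burned_after (unicyclic g l) q {1..g + l}"
  shows "g + l < q\<^sup>2 + q"
proof (cases "g + l \<le> q\<^sup>2")
  case False
  then obtain j e Y where "j < q" "e \<le> j" "{1..g + l} \<subseteq> hub_ball g e \<union> (\<Union>i<q. Y i)"
    "\<And>i. finite (Y i) \<and> card (Y i) \<le> 2 * i + 1" "card (Y j) \<le> 2 * (j - e)"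
    using burned_after_hub_decomposition[OF assms(1,3)] by auto
  then show ?thesis using order_le_of_hub_decomposition[where j = j and Y = Y and e = e and q = q] by fastforce
qed (use assms in simp)

text \<open>
  For this order the depth is \<open>e = q - 1\<close>, and outside the hub ball the other \<open>q - 1\<close> balls have to cover
  at least \<open>(q - 1)\<^sup>2\<close> vertices, which leaves no deficit. If just two of these vertices lie on the side
  \<open>S\<close>, the ball of radius \<open>0\<close> misses one of them. The ball that covers this one stays within \<open>S\<close>, so it covers
  at most \<open>2\<close> vertices although its radius is positive, and that is a deficit.
\<close>

lemma not_two_left_of_burned_after:
  assumes g: "3 \<le> g" and q: "2 \<le> q" and burned: "burned_after (unicyclic g l) q {1..g + l}"
    and order: "g + l + 1 = q\<^sup>2 + q" and S: "S = {..g} \<or> S = {g<..}"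
  shows "card (({1..g + l} - hub_ball g (q - 1)) \<inter> S) \<noteq> 2"
proof
  define R where "R = {1..g + l} - hub_ball g (q - 1)"
  assume "card (({1..g + l} - hub_ball g (q - 1)) \<inter> S) = 2"
  then have M: "card (R \<inter> S) = 2" by (simp add: R_def)
  obtain j e Y where je: "j < q" "e \<le> j"
    and cover: "{1..g + l} \<subseteq> hub_ball g e \<union> (\<Union>i<q. Y i)"
    and fin: "\<And>i. finite (Y i)" and cardY: "\<And>i. card (Y i) \<le> 2 * i + 1"
    and side: "\<And>i. Y i \<subseteq> {..g} \<or> Y i \<subseteq> {g<..}" and cardj: "card (Y j) \<le> 2 * (j - e)"
    using burned_after_hub_decomposition[OF g burned] order q by auto
  have "g + l \<le> q\<^sup>2 + e"
    by (rule order_le_of_hub_decomposition[OF cover je fin cardY cardj])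
  then have "e = q - 1" "j = q - 1" using je order by auto
  then have "Y (q - 1) = {}" using cardj fin by simp
  moreover have "{..<q} = insert (q - 1) {..<q - 1}" using q by auto
  ultimately have R: "R \<subseteq> (\<Union>i<q - 1. Y i \<inter> R)"
    using cover \<open>e = q - 1\<close> by (auto simp: R_def)
  have "\<not> R \<inter> S \<subseteq> Y 0"
    using card_mono[OF fin[of 0], of "R \<inter> S"] cardY[of 0] M by auto
  then obtain m i where m: "m \<in> R \<inter> S" "m \<notin> Y 0" "i < q - 1" "m \<in> Y i" using R by blast
  then have "Y i \<inter> R \<subseteq> R \<inter> S" using side[of i] S by fastforce
  then have "card (Y i \<inter> R) \<le> 2"
    using M card_mono[of "R \<inter> S" "Y i \<inter> R"] card_ge_0_finite[of "R \<inter> S"] by simp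
  moreover have "1 \<le> i" using m by (cases i) auto
  ultimately have "card (Y i \<inter> R) + 1 \<le> 2 * i + 1" by simp
  moreover have "card (Y i \<inter> R) \<le> 2 * i + 1" for i
    using card_mono[OF fin[of i], of "Y i \<inter> R"] cardY[of i] by simp
  ultimately have "card (\<Union>i<q - 1. Y i \<inter> R) + 1 \<le> (q - 1)\<^sup>2"
    using m by (intro card_UN_le_odd_sum[where j = i]) auto
  moreover have "card R \<le> card (\<Union>i<q - 1. Y i \<inter> R)"
    using R fin by (intro card_mono) auto
  moreover have "g + l \<le> card R + card (hub_ball g (q - 1))"
    using card_Un_le[of R "hub_ball g (q - 1)"] card_mono[of "R \<union> hub_ball g (q - 1)" "{1..g + l}"]
    by (auto simp: R_def finite_hub_ball)
  moreover have "card (hub_ball g (q - 1)) \<le> 3 * (q - 1) + 1" by (rule card_hub_ball_le)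
  moreover obtain p where "q = Suc p" using q by (cases q) auto
  ultimately show False using order by (auto simp: power2_eq_square)
qed

lemma hub_ball_eq:
  assumes "e < g"
  shows "hub_ball g e = {1..e} \<union> {g - e..g + e}"
proof -
  have "up_leg g ` {..e} = insert g {1..e}" using assms
    by (force simp: up_leg_def image_iff)
  moreover have "down_leg g ` {..e} = {g - e..g}"
  proof
    show "{g - e..g} \<subseteq> down_leg g ` {..e}"
    proof
      fix x assume "x \<in> {g - e..g}"
      then show "x \<in> down_leg g ` {..e}"
        using assms by (intro image_eqI[of _ _ "g - x"]) (auto simp: down_leg_def)
    qed
  qed (use assms in \<open>auto simp: down_leg_def\<close>)
  moreover have "(\<lambda>x. g + x) ` {..e} = {g..g + e}"
    by (simp add: atMost_atLeast0)
  ultimately show ?thesis by (auto simp: hub_ball_def legs_def)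
qed

section \<open>The burning number\<close>

theorem theorem3p7:
  fixes n g q r :: nat
  assumes "3 \<le> g" and "g \<le> n - 1" and "1 \<le> q"
    and "n = q^2 + r" and "1 \<le> r" and "r \<le> 2 * q + 1"
    and "(q \<le> r \<and> r \<le> 2 * q + 1) \<or> g \<ge> q^2 + 1 \<or> g \<le> 2 * r
      \<or> (int g, int n - int g) \<in>
          {(2 * int q + 1, (int q)^2 - int q - 2), ((int q)^2 - 2, int q + 1)}"
  shows "burning_number (unicyclic g (n - g)) = q + 1"
proof -
  define l where "l = n - g"
  have n: "g + l = q\<^sup>2 + r" using assms(2,4,5) by (simp add: l_def)
  have "\<not> burned_after (unicyclic g l) q {1..g + l}"
  proof
    assume burned: "burned_after (unicyclic g l) q {1..g + l}"
    have "r < q" using order_less_of_burned_after[OF assms(1,3) burned] n by simp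
    moreover have "g \<le> q\<^sup>2" by (rule girth_le_square_of_burned_after[OF assms(1) burned])
    moreover have "2 * r < g"
      using geodesic_le_square_of_burned_after[OF assms(1) burned] n by linarith
    ultimately consider "int g = 2 * int q + 1" "int l = (int q)\<^sup>2 - int q - 2"
      | "int g = (int q)\<^sup>2 - 2" "int l = int q + 1"
      using assms(2,7) by (auto simp: l_def of_nat_diff)
    then show False
    proof cases
      \<comment> \<open>The hub ball leaves the two cycle vertices opposite to the hub.\<close>
      case 1
      then have gl: "g = 2 * q + 1" "int (g + l + 1) = int (q\<^sup>2 + q)" by auto
      then have order: "g + l + 1 = q\<^sup>2 + q" by linarith
      have q: "2 \<le> q" using \<open>r < q\<close> assms(5) by simp
      have "({1..g + l} - hub_ball g (q - 1)) \<inter> {..g} = {q, q + 1}"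
        using gl(1) q by (subst hub_ball_eq) auto
      then show False
        using not_two_left_of_burned_after[OF assms(1) q burned order, of "{..g}"] by simp
    next
      \<comment> \<open>The hub ball leaves the last two vertices of the path.\<close>
      case 2
      then have gl: "l = q + 1" "int (g + l + 1) = int (q\<^sup>2 + q)" "int (g + 2) = int (q\<^sup>2)"
        by auto
      then have order: "g + l + 1 = q\<^sup>2 + q" and sq: "g + 2 = q\<^sup>2" by linarith+
      have q: "2 \<le> q" using \<open>r < q\<close> assms(5) by simp
      have "q < g"
      proof (cases "q = 2")
        case False
        then have "3 * q \<le> q\<^sup>2" using q by (simp add: power2_eq_square)
        then show ?thesis using sq q by linarith
      qed (use assms(1) sq in simp)
      then have "({1..g + l} - hub_ball g (q - 1)) \<inter> {g<..} = {g + q, g + q + 1}"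
        using gl(1) q by (subst hub_ball_eq) auto
      then show False
        using not_two_left_of_burned_after[OF assms(1) q burned order, of "{g<..}"] by simp
    qed
  qed
  then have "q + 1 \<le> k" if "burned_after (unicyclic g l) k {1..g + l}" for k
    using that burned_after_mono[of k q "unicyclic g l"] by (cases "k \<le> q") auto
  moreover have "burned_after (unicyclic g l) (q + 1) {1..g + l}"
    using n assms(6) by (intro unicyclic_burned_after_root[OF assms(1)])
      (simp add: power2_eq_square)
  ultimately show ?thesis
    unfolding burning_number_def l_def[symmetric] by (intro Least_equality) auto
qed

end
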